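(* Let $\gamma$ be a smooth strictly convex curve on the unit sphere $\mathbb{S}^2\subset\mathbb{R}^3$. Assume that $\gamma$ admits a non-vanishing normal vector field $N$ (tangent to the sphere) with the following property: for any distinct points $x,y\in\gamma$, one has $$ N(x)\cdot u = -N(y)\cdot v, $$ where $u$ and $v$ are the unit tangent vectors, at the points $x$ and $y$ respectively, to the geodesic connecting $x$ and $y$, oriented from $x$ to $y$. Then $\gamma$ is a (part of a) spherical conic.
   Context: The dot denotes the Euclidean scalar product in $\mathbb{R}^3$. A normal vector field $N$ along $\gamma$ assigns to each $x\in\gamma$ a vector $N(x)\in T_x\mathbb{S}^2$ orthogonal to the tangent line of $\gamma$ at $x$; it is not assumed to have unit length. Geodesics of $\mathbb{S}^2$ are arcs of great circles. For distinct non-antipodal $x,y\in\mathbb{S}^2$, the vectors $u$ and $v$ are the positive multiples of unit length of $y-(x\cdot y)\,x$ and $(x\cdot y)\,y-x$, respectively. A spherical conic is the intersection of $\mathbb{S}^2$ with a quadratic cone $\{x\in\mathbb{R}^3: Ax\cdot x=0\}$, where $A$ is a self-adjoint linear map of $\mathbb{R}^3$. *)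

theory Defs
  imports "HOL-Analysis.Analysis"
begin

text \<open>
  Derivatives are taken relative to the parameter interval, so that they are one-sided at
  endpoints belonging to it.
\<close>

definition velocity :: "real set \<Rightarrow> (real \<Rightarrow> real^3) \<Rightarrow> real \<Rightarrow> real^3" where
  "velocity I c t = vector_derivative c (at t within I)"

definition C_infinity_on :: "real set \<Rightarrow> (real \<Rightarrow> real^3) \<Rightarrow> bool" where
  "C_infinity_on I c \<longleftrightarrow> (\<forall>k. (velocity I ^^ k) c differentiable_on I)"

text \<open>
  A smooth curve on the unit sphere is the image of a regular simple parametrization.  It is
  either an arc (over an arbitrary nondegenerate interval, with or without endpoints) or a
  closed curve, which is given by a periodic parametrization over the whole line so that it is
  also smooth at the point where it closes up.
\<close>

definition smooth_spherical_curve :: "real set \<Rightarrow> (real \<Rightarrow> real^3) \<Rightarrow> bool" where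
  "smooth_spherical_curve I c \<longleftrightarrow>
     is_interval I \<and> interior I \<noteq> {} \<and>
     c ` I \<subseteq> sphere 0 1 \<and>
     C_infinity_on I c \<and> (\<forall>t\<in>I. velocity I c t \<noteq> 0) \<and>
     (inj_on c I \<or>
      I = UNIV \<and> (\<exists>T>0. (\<forall>t. c (t + T) = c t) \<and> inj_on c {0..<T}))"

text \<open>
  The great circle orthogonal to \<open>w\<close> is tangent to the curve at \<open>c s\<close> iff \<open>w\<close> is nonzero and
  orthogonal to \<open>c s\<close> and to the velocity there.  Strict convexity requires the tangent great
  circle at each point to have all other points of the curve strictly on one side.  In particular
  the antipode of a point of the curve, which lies on every great circle through that
  point, is not on the curve.
\<close>

definition strictly_convex_spherical :: "real set \<Rightarrow> (real \<Rightarrow> real^3) \<Rightarrow> bool" where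
  "strictly_convex_spherical I c \<longleftrightarrow>
     (\<forall>s\<in>I. \<exists>w. w \<noteq> 0 \<and> w \<bullet> c s = 0 \<and> w \<bullet> velocity I c s = 0 \<and>
        (\<forall>x \<in> c ` I - {c s}. w \<bullet> x > 0))"

text \<open>The field \<open>N\<close> is a function of the point on the curve, not of the parameter.\<close>

definition normal_field :: "real set \<Rightarrow> (real \<Rightarrow> real^3) \<Rightarrow> (real^3 \<Rightarrow> real^3) \<Rightarrow> bool" where
  "normal_field I c N \<longleftrightarrow>
     (\<forall>t\<in>I. N (c t) \<bullet> c t = 0 \<and> N (c t) \<bullet> velocity I c t = 0)"

text \<open>
  Unit tangent vectors, at \<open>x\<close> and at \<open>y\<close>, to the shorter great circle arc from \<open>x\<close> to \<open>y\<close>, for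
  distinct non-antipodal points \<open>x\<close>, \<open>y\<close> of the sphere.
\<close>

definition geodesic_start :: "real^3 \<Rightarrow> real^3 \<Rightarrow> real^3" where
  "geodesic_start x y = sgn (y - (x \<bullet> y) *\<^sub>R x)"

definition geodesic_end :: "real^3 \<Rightarrow> real^3 \<Rightarrow> real^3" where
  "geodesic_end x y = sgn ((x \<bullet> y) *\<^sub>R y - x)"

text \<open>
  The map \<open>A\<close> has to be nonzero: otherwise the equation is void and the whole sphere would
  qualify.
\<close>

definition spherical_conic :: "(real^3) set \<Rightarrow> bool" where
  "spherical_conic C \<longleftrightarrow>
     (\<exists>A :: real^3 \<Rightarrow> real^3. linear A \<and> adjoint A = A \<and> A \<noteq> (\<lambda>x. 0) \<and>
        C = sphere 0 1 \<inter> {x. A x \<bullet> x = 0})"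

end

theory Submission
  imports Defs
begin

text \<open>
  The vectors \<open>y - (x \<bullet> y) x\<close> and \<open>(x \<bullet> y) y - x\<close> have the same length, and \<open>N(x)\<close> is orthogonal
  to \<open>x\<close>.  Hence, once the common length is cancelled, the hypothesis on the pairs of points is
  the symmetry \<open>N(x) \<bullet> y = N(y) \<bullet> x\<close> on the curve.  A field with this symmetry on a spanning
  set is the restriction of a self-adjoint linear map \<open>A\<close> (\<open>symmetric_on_spanning_imp_selfadjoint\<close>):
  extend \<open>N\<close> linearly from a basis contained in the set; the symmetry makes the extension
  self-adjoint, and then forces it to agree with \<open>N\<close> at the remaining points.  So on the curve
  \<open>A x \<bullet> x = N(x) \<bullet> x = 0\<close>, which is the equation of a spherical conic, with \<open>A \<noteq> 0\<close> because
  \<open>N\<close> does not vanish.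

  Strict convexity excludes antipodal pairs, for which the common length would be zero, and makes
  the curve span the space: any three distinct points of it are linearly independent
  (\<open>supported_triple_independent\<close>), because each of them lies on a plane through the origin that
  leaves the other two strictly on one side.
\<close>

lemma inner_zero_on_spanning_imp_zero:
  fixes z :: "'a::real_inner"
  assumes "span B = UNIV" and "\<And>b. b \<in> B \<Longrightarrow> z \<bullet> b = 0"
  shows "z = 0"
proof -
  have "z \<in> span B" using assms(1) by simp
  then have "orthogonal z z"
    by (rule orthogonal_to_span) (simp add: orthogonal_def assms(2))
  then show ?thesis by (simp add: orthogonal_def)
qed

text \<open>
  The values of \<open>N\<close> on a basis contained in \<open>S\<close> determine it on \<open>S\<close>: the inner products of
  \<open>N(x)\<close> with the basis vectors \<open>b\<close> are \<open>N(b) \<bullet> x\<close>, and these are linear in \<open>x\<close>.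
\<close>

lemma symmetric_on_spanning_imp_selfadjoint:
  fixes N :: "'a::euclidean_space \<Rightarrow> 'a"
  assumes span: "span S = UNIV"
    and sym: "\<And>x y. x \<in> S \<Longrightarrow> y \<in> S \<Longrightarrow> N x \<bullet> y = N y \<bullet> x"
  obtains A where "linear A" and "adjoint A = A" and "\<And>x. x \<in> S \<Longrightarrow> A x = N x"
proof -
  obtain B where B: "B \<subseteq> S" "independent B" "span B = UNIV"
    using basis_exists[of S] span span_mono[of S "span _"]
    by (metis UNIV_I span_span subset_antisym subset_UNIV)
  obtain A where A: "linear A" and AB: "\<And>b. b \<in> B \<Longrightarrow> A b = N b"
    using linear_independent_extend[OF B(2), of N] by blast
  have adjA: "linear (adjoint A)"
    by (rule adjoint_linear[OF A])
  have "adjoint A b = A b" if b: "b \<in> B" for b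
  proof -
    have "(adjoint A b - A b) \<bullet> d = 0" if d: "d \<in> B" for d
    proof -
      have "adjoint A b \<bullet> d = N d \<bullet> b"
        using adjoint_works[OF A, of d b] by (simp add: AB d inner_commute)
      also have "\<dots> = A b \<bullet> d"
        using sym[of d b] b d B(1) AB[OF b] by auto
      finally show ?thesis by (simp add: inner_diff_left)
    qed
    then have "adjoint A b - A b = 0"
      by (rule inner_zero_on_spanning_imp_zero[OF B(3)])
    then show ?thesis by simp
  qed
  then have self: "adjoint A = A"
    using linear_eq_on_span[OF adjA A, of B] B(3) by auto
  have "A x = N x" if x: "x \<in> S" for x
  proof -
    have "(A x - N x) \<bullet> b = 0" if b: "b \<in> B" for b
    proof -
      have "A x \<bullet> b = N b \<bullet> x"
        using adjoint_works[OF A, of b x] by (simp add: self AB b inner_commute)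
      then show ?thesis
        using sym[of x b] x b B(1) by (auto simp: inner_diff_left)
    qed
    then have "A x - N x = 0"
      by (rule inner_zero_on_spanning_imp_zero[OF B(3)])
    then show ?thesis by simp
  qed
  then show thesis using that A self by blast
qed

text \<open>
  Pairing a relation \<open>\<alpha> x + \<beta> y + \<delta> z = 0\<close> with the vector supporting at \<open>x\<close> shows that \<open>\<beta>\<close> and
  \<open>\<delta>\<close> are both zero or have opposite signs.  The same holds for the other two pairs, but three
  numbers cannot have pairwise opposite signs.
\<close>

lemma supported_triple_independent:
  fixes x y z :: "'a::real_inner"
  assumes u: "u \<bullet> x = 0" "u \<bullet> y > 0" "u \<bullet> z > 0"
    and v: "v \<bullet> y = 0" "v \<bullet> x > 0" "v \<bullet> z > 0"
    and w: "w \<bullet> z = 0" "w \<bullet> x > 0" "w \<bullet> y > 0"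
  shows "independent {x, y, z}"
proof -
  have opposite: "p * q < 0 \<or> p = 0 \<and> q = 0" if "p * r + q * s = 0" "r > 0" "s > 0"
    for p q r s :: real
  proof -
    have p: "p = - q * (s / r)" using that by (simp add: field_simps)
    then have pq: "p * q = - (q\<^sup>2 * (s / r))" by (simp add: power2_eq_square)
    show ?thesis
    proof (cases "q = 0")
      case False
      then have "q\<^sup>2 * (s / r) > 0" using that by simp
      then show ?thesis using pq by linarith
    qed (simp add: p)
  qed
  have distinct: "x \<noteq> y" "x \<noteq> z" "y \<noteq> z" using u v by auto
  have zero: "\<alpha> = 0 \<and> \<beta> = 0 \<and> \<delta> = 0"
    if rel: "\<alpha> *\<^sub>R x + \<beta> *\<^sub>R y + \<delta> *\<^sub>R z = 0" for \<alpha> \<beta> \<delta>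
  proof -
    have pair: "\<alpha> * (n \<bullet> x) + \<beta> * (n \<bullet> y) + \<delta> * (n \<bullet> z) = 0" for n
      using arg_cong[OF rel, of "\<lambda>p. n \<bullet> p"] by (simp add: inner_add_right)
    have "\<beta> * \<delta> < 0 \<or> \<beta> = 0 \<and> \<delta> = 0"
      using opposite[OF _ u(2,3), of \<beta> \<delta>] pair[of u] u(1) by simp
    moreover have "\<alpha> * \<delta> < 0 \<or> \<alpha> = 0 \<and> \<delta> = 0"
      using opposite[OF _ v(2,3), of \<alpha> \<delta>] pair[of v] v(1) by simp
    moreover have "\<alpha> * \<beta> < 0 \<or> \<alpha> = 0 \<and> \<beta> = 0"
      using opposite[OF _ w(2,3), of \<alpha> \<beta>] pair[of w] w(1) by simp
    ultimately show ?thesis by (auto simp: mult_less_0_iff)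
  qed
  show ?thesis
    using zero[of "c x" "c y" "c z" for c] distinct
    by (auto simp: dependent_finite add.assoc)
qed

lemma smooth_spherical_curve_infinite:
  assumes "smooth_spherical_curve I c"
  shows "infinite (c ` I)"
proof -
  have "infinite I"
    using assms empty_interior_finite unfolding smooth_spherical_curve_def by blast
  moreover have "infinite (c ` I)" if "T > 0" "inj_on c {0..<T}" "I = UNIV" for T
    using that finite_imageD[of c "{0..<T}"] infinite_Ico[of 0 T]
    by (metis finite_subset image_mono subset_UNIV)
  ultimately show ?thesis
    using assms finite_imageD[of c I] unfolding smooth_spherical_curve_def by metis
qed

text \<open>
  Three points suffice to span because the ambient space has dimension three; for an infinite
  curve they can be chosen distinct.
\<close>

lemma strictly_convex_spherical_span:
  assumes convex: "strictly_convex_spherical I c" and inf: "infinite (c ` I)"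
  shows "span (c ` I) = UNIV"
proof -
  obtain P where P: "P \<subseteq> c ` I" "card P = 3"
    using infinite_arbitrarily_large[OF inf] by metis
  then obtain x y z where xyz: "P = {x, y, z}" "x \<noteq> y" "x \<noteq> z" "y \<noteq> z"
    by (auto simp: card_3_iff)
  have supp: "\<exists>n. n \<bullet> p = 0 \<and> (\<forall>q \<in> c ` I - {p}. n \<bullet> q > 0)" if "p \<in> c ` I" for p
    using convex that unfolding strictly_convex_spherical_def by blast
  obtain u v w where
    "u \<bullet> x = 0" "\<forall>q \<in> c ` I - {x}. u \<bullet> q > 0"
    "v \<bullet> y = 0" "\<forall>q \<in> c ` I - {y}. v \<bullet> q > 0"
    "w \<bullet> z = 0" "\<forall>q \<in> c ` I - {z}. w \<bullet> q > 0"
    using supp[of x] supp[of y] supp[of z] P(1) xyz(1) by auto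
  then have "independent P"
    using supported_triple_independent[of u x y z v w] P(1) xyz by simp
  then have "span P = UNIV"
    using card_ge_dim_independent[of P UNIV] P(2) by (simp add: top.extremum_unique)
  then show ?thesis using span_mono[OF P(1)] by auto
qed

lemma norm_geodesic_directions_eq:
  fixes x y :: "'a::real_inner"
  assumes "norm x = 1" "norm y = 1"
  shows "norm ((x \<bullet> y) *\<^sub>R y - x) = norm (y - (x \<bullet> y) *\<^sub>R x)"
  using assms
  by (simp add: norm_eq_sqrt_inner inner_diff_left inner_diff_right inner_commute algebra_simps)

text \<open>
  Both sides carry the factor \<open>1 / r\<close>, where \<open>r\<close> is the common length of the two directions
  before normalization.  By the equality case of the Cauchy-Schwarz inequality it is zero only if
  \<open>y\<close> is \<open>x\<close> or its antipode.
\<close>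

lemma geodesic_condition_imp_symmetric:
  fixes x y a b :: "real^3"
  assumes unit: "norm x = 1" "norm y = 1" and "x \<noteq> y" "y \<noteq> - x"
    and orth: "a \<bullet> x = 0" "b \<bullet> y = 0"
    and eq: "a \<bullet> geodesic_start x y = - (b \<bullet> geodesic_end x y)"
  shows "a \<bullet> y = b \<bullet> x"
proof -
  define r where "r = norm (y - (x \<bullet> y) *\<^sub>R x)"
  have "r \<noteq> 0"
  proof
    assume "r = 0"
    then have y: "y = (x \<bullet> y) *\<^sub>R x" by (simp add: r_def)
    then have "norm y = \<bar>x \<bullet> y\<bar> * norm x" by (metis norm_scaleR)
    then have "\<bar>x \<bullet> y\<bar> = 1" using unit by simp
    then have "x \<bullet> y = 1 \<or> x \<bullet> y = - 1" by linarith
    then show False using y \<open>x \<noteq> y\<close> \<open>y \<noteq> - x\<close> by (metis scaleR_minus1_left scaleR_one)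
  qed
  moreover have "a \<bullet> geodesic_start x y = (a \<bullet> y) / r"
    unfolding geodesic_start_def sgn_div_norm r_def[symmetric]
    by (simp add: inner_diff_right orth divide_inverse)
  moreover have "b \<bullet> geodesic_end x y = - (b \<bullet> x) / r"
    unfolding geodesic_end_def sgn_div_norm norm_geodesic_directions_eq[OF unit] r_def[symmetric]
    by (simp add: inner_diff_right orth divide_inverse)
  ultimately show ?thesis using eq by simp
qed

theorem theorem2:
  fixes I :: "real set" and c :: "real \<Rightarrow> real^3" and \<gamma> :: "(real^3) set"
    and N :: "real^3 \<Rightarrow> real^3"
  assumes "smooth_spherical_curve I c"
    and "\<gamma> = c ` I"
    and "strictly_convex_spherical I c"
    and "normal_field I c N"
    and "\<forall>x\<in>\<gamma>. N x \<noteq> 0"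
    and "\<forall>x\<in>\<gamma>. \<forall>y\<in>\<gamma>. x \<noteq> y \<longrightarrow>
           N x \<bullet> geodesic_start x y = - (N y \<bullet> geodesic_end x y)"
  shows "\<exists>C. spherical_conic C \<and> \<gamma> \<subseteq> C"
proof -
  have inf: "infinite \<gamma>"
    using smooth_spherical_curve_infinite[OF assms(1)] assms(2) by simp
  have span: "span \<gamma> = UNIV"
    using strictly_convex_spherical_span[OF assms(3)] inf assms(2) by simp
  have unit: "norm x = 1" if "x \<in> \<gamma>" for x
    using assms(1,2) that unfolding smooth_spherical_curve_def by auto
  have orth: "N x \<bullet> x = 0" if "x \<in> \<gamma>" for x
    using assms(2,4) that unfolding normal_field_def by auto
  have antipode: "y \<noteq> - x" if x: "x \<in> \<gamma>" and y: "y \<in> \<gamma>" for x y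
  proof
    assume eq: "y = - x"
    obtain w where w: "w \<bullet> x = 0" "\<forall>q\<in>\<gamma> - {x}. w \<bullet> q > 0"
      using assms(2,3) x unfolding strictly_convex_spherical_def by blast
    have "x \<bullet> y = - 1" using eq unit[OF x] by (simp add: norm_eq_1)
    then have "y \<noteq> x" using unit[OF x] by (auto simp: norm_eq_1)
    then have "w \<bullet> y > 0" using w(2) y by blast
    then show False using eq w(1) by simp
  qed
  have "N x \<bullet> y = N y \<bullet> x" if "x \<in> \<gamma>" "y \<in> \<gamma>" for x y
  proof (cases "x = y")
    case False
    then show ?thesis
      using geodesic_condition_imp_symmetric[of x y "N x" "N y"] that
        unit orth antipode assms(6) by blast
  qed simp
  then obtain A where A: "linear A" "adjoint A = A" and AN: "\<And>x. x \<in> \<gamma> \<Longrightarrow> A x = N x"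
    using symmetric_on_spanning_imp_selfadjoint[OF span, of N] by blast
  obtain p where "p \<in> \<gamma>" using inf by fastforce
  then have "A p \<noteq> 0" using AN assms(5) by simp
  then have "A \<noteq> (\<lambda>x. 0)" by auto
  then have "spherical_conic (sphere 0 1 \<inter> {x. A x \<bullet> x = 0})"
    using A unfolding spherical_conic_def by blast
  moreover have "\<gamma> \<subseteq> sphere 0 1 \<inter> {x. A x \<bullet> x = 0}"
    using unit orth AN by auto
  ultimately show ?thesis by blast
qed

end
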